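(* Let $(S,+)$ be a semigroup and let $(S,\cdot)$ be a group with identity $e$ on the same set $S$. Let $(\mathrm{P})$ be any one of the following four conditions on a map $\mu:S\to S$: (i) $e+\mu(x)=\mu(x)$ for all $x\in S$; (ii) $\mu(x)+e=\mu(x)$ for all $x\in S$; (iii) $x+\mu(x)+x=x$ for all $x\in S$; (iv) $\mu(x)+x+\mu(x)=\mu(x)$ for all $x\in S$. Then $(S,+,\cdot)$ is a strong left semibrace if and only if there exists a map $\mu:S\to S$ satisfying $(\mathrm{P})$ such that $(S,+,\cdot,\mu)$ is a near left semibrace.
   Context: Multiplication has higher precedence than addition. A left semibrace is a triple $(S,+,\cdot)$ such that $(S,+)$ is a (not necessarily commutative) semigroup, $(S,\cdot)$ is a group, and $x(y+z)=xy+x(x^{-1}+z)$ for all $x,y,z\in S$, where $x^{-1}$ is the inverse of $x$ in $(S,\cdot)$. For $a\in S$ let $\overline{\rho}_a:S\to S$, $b\mapsto(b^{-1}+a)^{-1}a$. A left semibrace is called strong if $a\mapsto\overline{\rho}_a$ is a semigroup anti-homomorphism from $(S,\cdot)$ to the semigroup of maps $S\to S$ under composition, i.e. $\overline{\rho}_{ab}=\overline{\rho}_b\circ\overline{\rho}_a$ for all $a,b\in S$. A near left semibrace is a quadruple $(S,+,\cdot,\mu)$ where $(S,+)$ is a semigroup, $(S,\cdot)$ is a group, and $\mu:S\to S$ is a map such that $x(y+z)=xy+\mu(x)+xz$ for all $x,y,z\in S$. *)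

theory Defs
  imports "HOL-Algebra.Group"
begin

(* The monoid part of the record is the multiplicative structure. The ring record of HOL-Algebra
   is not used because it would add a distinguished, here meaningless, zero element. *)
record 'a add_mult = "'a monoid" +
  add :: "'a \<Rightarrow> 'a \<Rightarrow> 'a"  (infixl \<open>\<oplus>\<index>\<close> 65)

locale add_semigroup =
  fixes S (structure)
  assumes add_closed: "\<lbrakk>x \<in> carrier S; y \<in> carrier S\<rbrakk> \<Longrightarrow> x \<oplus> y \<in> carrier S"
    and add_assoc: "\<lbrakk>x \<in> carrier S; y \<in> carrier S; z \<in> carrier S\<rbrakk>
      \<Longrightarrow> (x \<oplus> y) \<oplus> z = x \<oplus> (y \<oplus> z)"

locale left_semibrace = add_semigroup S + group S for S (structure) +
  assumes semibrace_distrib: "\<lbrakk>x \<in> carrier S; y \<in> carrier S; z \<in> carrier S\<rbrakk>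
      \<Longrightarrow> x \<otimes> (y \<oplus> z) = (x \<otimes> y) \<oplus> (x \<otimes> (inv x \<oplus> z))"

(* Maps S \<rightarrow> S are restricted to the carrier, so that equality of maps is equality on S. *)
definition rho_bar :: "('a, 'b) add_mult_scheme \<Rightarrow> 'a \<Rightarrow> 'a \<Rightarrow> 'a" where
  "rho_bar S a = (\<lambda>b\<in>carrier S. inv\<^bsub>S\<^esub> (inv\<^bsub>S\<^esub> b \<oplus>\<^bsub>S\<^esub> a) \<otimes>\<^bsub>S\<^esub> a)"

locale strong_left_semibrace = left_semibrace +
  assumes rho_bar_antihom: "\<lbrakk>a \<in> carrier S; b \<in> carrier S\<rbrakk>
      \<Longrightarrow> rho_bar S (a \<otimes> b) = compose (carrier S) (rho_bar S b) (rho_bar S a)"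

locale near_left_semibrace = add_semigroup S + group S for S (structure) +
  fixes \<mu> :: "'a \<Rightarrow> 'a"
  assumes mu_closed: "\<mu> \<in> carrier S \<rightarrow> carrier S"
    and near_distrib: "\<lbrakk>x \<in> carrier S; y \<in> carrier S; z \<in> carrier S\<rbrakk>
      \<Longrightarrow> x \<otimes> (y \<oplus> z) = (x \<otimes> y) \<oplus> \<mu> x \<oplus> (x \<otimes> z)"

end

theory Submission
  imports Defs
begin

text \<open>
  Everything turns on one property of the multiplicative identity: \<open>u \<oplus> \<one> \<oplus> v = u \<oplus> v\<close> for all
  \<open>u\<close>, \<open>v\<close>; call this \<open>\<one>\<close> being middle neutral. It is convenient to read it modulo the
  congruence \<open>p \<equiv> q\<close> that identifies \<open>p\<close> and \<open>q\<close> when \<open>u \<oplus> p \<oplus> v = u \<oplus> q \<oplus> v\<close> for all \<open>u\<close>, \<open>v\<close>.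
  In a near left semibrace \<open>\<mu> \<one>\<close> is always a neutral element of the quotient (put \<open>x = \<one>\<close> in the
  distributive law), and the claim is that \<open>\<one>\<close> is congruent to it.

  The condition on \<open>\<rho>\<close>-bar unravels to the left-right mirror image of the semibrace law
  (\<open>strong_iff_mirror_distrib\<close>), so a strong left semibrace satisfies
  \<open>x \<otimes> (y \<oplus> z) = x \<otimes> y \<oplus> x \<otimes> (inv x \<oplus> z) = x \<otimes> (y \<oplus> inv x) \<oplus> x \<otimes> z\<close>. With \<open>x = \<one>\<close> the
  first equality says that \<open>\<one>\<close> is middle neutral; applying the second to \<open>x \<otimes> (inv x \<oplus> z)\<close> inside
  the first makes \<open>\<mu> x = x \<otimes> (inv x \<oplus> inv x)\<close> a near left semibrace structure. Conversely, if \<open>\<one>\<close>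
  is middle neutral, then near distributivity gives both laws. Hence strong means: near for some
  \<open>\<mu>\<close>, with \<open>\<one>\<close> middle neutral (\<open>strong_if_middle_neutral\<close>, \<open>strong_imp_near\<close>).

  It remains to see that, for near structures, each of the four conditions forces \<open>\<one>\<close> to be middle
  neutral, and that \<open>\<mu>\<close> can be changed within its congruence class to satisfy any of them
  when \<open>\<one>\<close> is middle neutral. The third condition is the delicate one in both directions: it is
  tied to \<open>\<one> \<oplus> \<one> = \<one>\<close>, because \<open>x \<oplus> \<mu> x \<oplus> x = x \<otimes> (\<one> \<oplus> \<one>)\<close>. That \<open>\<one>\<close> is neutral in the
  quotient follows from its idempotence because all \<open>\<mu> x\<close> are invertible there
  (\<open>neutral_if_one_idem\<close>); the converse must recover an equation in \<open>S\<close> itself, which works because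
  \<open>\<one>\<close> can be written as a sum (\<open>one_idem_if_neutral\<close>). Replacing \<open>\<mu> x\<close> by \<open>\<mu> x \<oplus> x \<oplus> \<mu> x\<close> then
  passes from the third condition to the fourth.
\<close>

definition middle_neutral :: "('a, 'b) add_mult_scheme \<Rightarrow> 'a \<Rightarrow> bool" where
  "middle_neutral S n \<longleftrightarrow> (\<forall>u\<in>carrier S. \<forall>v\<in>carrier S. u \<oplus>\<^bsub>S\<^esub> n \<oplus>\<^bsub>S\<^esub> v = u \<oplus>\<^bsub>S\<^esub> v)"

lemma middle_neutralI:
  fixes S (structure)
  assumes "\<And>u v. u \<in> carrier S \<Longrightarrow> v \<in> carrier S \<Longrightarrow> u \<oplus> n \<oplus> v = u \<oplus> v"
  shows "middle_neutral S n"
  using assms by (simp add: middle_neutral_def)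

lemma middle_neutralD:
  fixes S (structure)
  assumes "middle_neutral S n" "u \<in> carrier S" "v \<in> carrier S"
  shows "u \<oplus> n \<oplus> v = u \<oplus> v"
  using assms by (simp add: middle_neutral_def)

section \<open>Strong left semibraces as two-sided distributivity\<close>

text \<open>
  Cancelling the last factor and inverting turns the anti-homomorphism law for \<open>a\<close>, \<open>c\<close> at \<open>b\<close> into
  \<open>inv a \<otimes> (inv b \<oplus> a \<otimes> c) = inv a \<otimes> (inv b \<oplus> a) \<oplus> c\<close>, and \<open>x = inv a\<close>, \<open>y = inv b\<close>,
  \<open>z = a \<otimes> c\<close> range over all of the group.
\<close>

lemma (in left_semibrace) strong_iff_mirror_distrib:
  "strong_left_semibrace S \<longleftrightarrow>
    (\<forall>x\<in>carrier S. \<forall>y\<in>carrier S. \<forall>z\<in>carrier S.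
      x \<otimes> (y \<oplus> z) = x \<otimes> (y \<oplus> inv x) \<oplus> x \<otimes> z)"
proof -
  have pointwise: "rho_bar S (a \<otimes> c) b = compose (carrier S) (rho_bar S c) (rho_bar S a) b \<longleftrightarrow>
      inv a \<otimes> (inv b \<oplus> a \<otimes> c) = inv a \<otimes> (inv b \<oplus> a) \<oplus> c"
    if "a \<in> carrier S" "b \<in> carrier S" "c \<in> carrier S" for a b c
  proof -
    define p where "p = inv b \<oplus> a \<otimes> c"
    define q where "q = inv a \<otimes> (inv b \<oplus> a) \<oplus> c"
    have pq: "p \<in> carrier S" "q \<in> carrier S"
      using that by (simp_all add: p_def q_def add_closed)
    have "rho_bar S (a \<otimes> c) b = inv p \<otimes> a \<otimes> c"
      using that pq by (simp add: rho_bar_def p_def m_assoc)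
    also have "\<dots> = inv (inv a \<otimes> p) \<otimes> c"
      using that pq by (simp add: inv_mult_group)
    finally have l: "rho_bar S (a \<otimes> c) b = inv (inv a \<otimes> p) \<otimes> c" .
    have r: "compose (carrier S) (rho_bar S c) (rho_bar S a) b = inv q \<otimes> c"
      using that by (simp add: rho_bar_def compose_def q_def add_closed inv_mult_group)
    show ?thesis
      unfolding l r using that pq
      by (simp add: inj_on_eq_iff[OF inv_inj] flip: p_def q_def)
  qed
  show ?thesis
  proof
    assume "strong_left_semibrace S"
    then interpret strong_left_semibrace S .
    show "\<forall>x\<in>carrier S. \<forall>y\<in>carrier S. \<forall>z\<in>carrier S.
      x \<otimes> (y \<oplus> z) = x \<otimes> (y \<oplus> inv x) \<oplus> x \<otimes> z"
    proof (intro ballI)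
      fix x y z assume xyz: "x \<in> carrier S" "y \<in> carrier S" "z \<in> carrier S"
      have "inv (inv x) \<otimes> (inv (inv y) \<oplus> inv x \<otimes> (x \<otimes> z)) =
          inv (inv x) \<otimes> (inv (inv y) \<oplus> inv x) \<oplus> x \<otimes> z"
        by (rule pointwise[THEN iffD1, OF _ _ _ fun_cong[OF rho_bar_antihom]])
          (simp_all add: xyz)
      then show "x \<otimes> (y \<oplus> z) = x \<otimes> (y \<oplus> inv x) \<oplus> x \<otimes> z"
        using xyz by (simp flip: m_assoc)
    qed
  next
    assume mirror: "\<forall>x\<in>carrier S. \<forall>y\<in>carrier S. \<forall>z\<in>carrier S.
      x \<otimes> (y \<oplus> z) = x \<otimes> (y \<oplus> inv x) \<oplus> x \<otimes> z"
    show "strong_left_semibrace S"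
    proof
      fix a c assume ac: "a \<in> carrier S" "c \<in> carrier S"
      show "rho_bar S (a \<otimes> c) = compose (carrier S) (rho_bar S c) (rho_bar S a)"
      proof
        fix b
        show "rho_bar S (a \<otimes> c) b = compose (carrier S) (rho_bar S c) (rho_bar S a) b"
        proof (cases "b \<in> carrier S")
          case True
          have "inv a \<otimes> (inv b \<oplus> a \<otimes> c) = inv a \<otimes> (inv b \<oplus> a) \<oplus> c"
            using mirror[rule_format, of "inv a" "inv b" "a \<otimes> c"] ac True
            by (simp flip: m_assoc)
          then show ?thesis
            using pointwise ac True by simp
        next
          case False
          then show ?thesis
            by (simp add: rho_bar_def compose_def)
        qed
      qed
    qed
  qed
qed

lemma (in left_semibrace) one_middle_neutral: "middle_neutral S \<one>"
proof (rule middle_neutralI)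
  fix u v assume "u \<in> carrier S" "v \<in> carrier S"
  then show "u \<oplus> \<one> \<oplus> v = u \<oplus> v"
    using semibrace_distrib[of \<one> u v] by (simp add: add_closed add_assoc)
qed

lemma (in strong_left_semibrace) strong_imp_near:
  "near_left_semibrace S (\<lambda>x. x \<otimes> (inv x \<oplus> inv x))"
proof
  show "(\<lambda>x. x \<otimes> (inv x \<oplus> inv x)) \<in> carrier S \<rightarrow> carrier S"
    by (simp add: add_closed)
next
  fix x y z assume xyz: "x \<in> carrier S" "y \<in> carrier S" "z \<in> carrier S"
  have "x \<otimes> (inv x \<oplus> z) = x \<otimes> (inv x \<oplus> inv x) \<oplus> x \<otimes> z"
    using strong_iff_mirror_distrib strong_left_semibrace_axioms xyz inv_closed by blast
  then show "x \<otimes> (y \<oplus> z) = x \<otimes> y \<oplus> x \<otimes> (inv x \<oplus> inv x) \<oplus> x \<otimes> z"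
    using semibrace_distrib[of x y z] xyz by (simp add: add_closed add_assoc)
qed

context near_left_semibrace
begin

lemma mu_in_carrier: "x \<in> carrier S \<Longrightarrow> \<mu> x \<in> carrier S"
  using mu_closed by blast

lemmas closed = add_closed mu_in_carrier

lemma strong_if_middle_neutral:
  assumes neutral: "middle_neutral S \<one>"
  shows "strong_left_semibrace S"
proof -
  interpret left_semibrace S
  proof
    fix x y z assume xyz: "x \<in> carrier S" "y \<in> carrier S" "z \<in> carrier S"
    show "x \<otimes> (y \<oplus> z) = x \<otimes> y \<oplus> x \<otimes> (inv x \<oplus> z)"
      using middle_neutralD[OF neutral, of "x \<otimes> y" "\<mu> x \<oplus> x \<otimes> z"] xyz
      by (simp add: near_distrib closed add_assoc)
  qed
  have "x \<otimes> (y \<oplus> z) = x \<otimes> (y \<oplus> inv x) \<oplus> x \<otimes> z"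
    if xyz: "x \<in> carrier S" "y \<in> carrier S" "z \<in> carrier S" for x y z
    using middle_neutralD[OF neutral, of "x \<otimes> y \<oplus> \<mu> x" "x \<otimes> z"] xyz
    by (simp add: near_distrib closed)
  then show ?thesis
    using strong_iff_mirror_distrib by blast
qed

section \<open>Each condition makes the multiplicative identity middle neutral\<close>

lemma mu_one_middle_neutral: "middle_neutral S (\<mu> \<one>)"
proof (rule middle_neutralI)
  fix u v assume "u \<in> carrier S" "v \<in> carrier S"
  then show "u \<oplus> \<mu> \<one> \<oplus> v = u \<oplus> v"
    using near_distrib[of \<one> u v] by (simp add: closed)
qed

text \<open>
  Multiplication by \<open>x\<close> undoes multiplication by \<open>inv x\<close>. Expanding \<open>x \<otimes> (inv x \<otimes> (u \<oplus> v))\<close> by near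
  distributivity shows that the class of \<open>\<mu> x\<close> has a right and a left inverse.
\<close>

lemma mu_invertible:
  assumes "x \<in> carrier S"
  shows "middle_neutral S (\<mu> x \<oplus> x \<otimes> \<mu> (inv x) \<oplus> \<mu> x)"
proof (rule middle_neutralI)
  fix u v assume uv: "u \<in> carrier S" "v \<in> carrier S"
  let ?w = "inv x"
  have "u \<oplus> v = x \<otimes> (?w \<otimes> (u \<oplus> v))"
    using assms uv by (simp add: closed flip: m_assoc)
  also have "\<dots> = u \<oplus> (\<mu> x \<oplus> x \<otimes> \<mu> ?w \<oplus> \<mu> x) \<oplus> v"
    using assms uv by (simp add: near_distrib closed add_assoc flip: m_assoc)
  finally show "u \<oplus> (\<mu> x \<oplus> x \<otimes> \<mu> ?w \<oplus> \<mu> x) \<oplus> v = u \<oplus> v" ..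
qed

lemma neutral_if_left_absorbed:
  assumes "\<one> \<oplus> \<mu> \<one> = \<mu> \<one>"
  shows "middle_neutral S \<one>"
proof (rule middle_neutralI)
  fix u v assume uv: "u \<in> carrier S" "v \<in> carrier S"
  have "u \<oplus> \<one> \<oplus> v = u \<oplus> (\<one> \<oplus> \<mu> \<one>) \<oplus> v"
    using middle_neutralD[OF mu_one_middle_neutral, of "u \<oplus> \<one>" v] uv
    by (simp add: closed add_assoc)
  also have "\<dots> = u \<oplus> v"
    using middle_neutralD[OF mu_one_middle_neutral] uv by (simp add: assms)
  finally show "u \<oplus> \<one> \<oplus> v = u \<oplus> v" .
qed

lemma neutral_if_right_absorbed:
  assumes "\<mu> \<one> \<oplus> \<one> = \<mu> \<one>"
  shows "middle_neutral S \<one>"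
proof (rule middle_neutralI)
  fix u v assume uv: "u \<in> carrier S" "v \<in> carrier S"
  have "u \<oplus> \<one> \<oplus> v = u \<oplus> (\<mu> \<one> \<oplus> \<one>) \<oplus> v"
    using middle_neutralD[OF mu_one_middle_neutral, of u "\<one> \<oplus> v"] uv
    by (simp add: closed add_assoc)
  also have "\<dots> = u \<oplus> v"
    using middle_neutralD[OF mu_one_middle_neutral] uv by (simp add: assms)
  finally show "u \<oplus> \<one> \<oplus> v = u \<oplus> v" .
qed

lemma neutral_if_absorbed_between:
  assumes "\<mu> \<one> \<oplus> \<one> \<oplus> \<mu> \<one> = \<mu> \<one>"
  shows "middle_neutral S \<one>"
proof (rule middle_neutralI)
  fix u v assume uv: "u \<in> carrier S" "v \<in> carrier S"
  have "u \<oplus> \<one> \<oplus> v = u \<oplus> \<mu> \<one> \<oplus> \<one> \<oplus> \<mu> \<one> \<oplus> v"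
    using middle_neutralD[OF mu_one_middle_neutral] uv by (simp add: closed)
  also have "\<dots> = u \<oplus> (\<mu> \<one> \<oplus> \<one> \<oplus> \<mu> \<one>) \<oplus> v"
    using uv by (simp add: closed add_assoc)
  also have "\<dots> = u \<oplus> v"
    using middle_neutralD[OF mu_one_middle_neutral] uv by (simp add: assms)
  finally show "u \<oplus> \<one> \<oplus> v = u \<oplus> v" .
qed

text \<open>
  Multiply the neutrality of \<open>\<mu> \<one>\<close> by \<open>x = inv (\<mu> \<one>)\<close>, which sends \<open>\<mu> \<one>\<close> to \<open>\<one>\<close>: with \<open>m = \<mu> x\<close> it
  becomes \<open>m \<oplus> \<one> \<oplus> m \<equiv> m\<close>. As the class of \<open>m\<close> is invertible, \<open>\<one> \<oplus> m\<close> is neutral, so \<open>\<one>\<close> is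
  right invertible, and a right invertible idempotent is neutral.
\<close>

lemma neutral_if_one_idem:
  assumes idem: "\<one> \<oplus> \<one> = \<one>"
  shows "middle_neutral S \<one>"
proof -
  define x where "x = inv (\<mu> \<one>)"
  define m where "m = \<mu> x"
  define n where "n = x \<otimes> \<mu> (inv x)"
  have x: "x \<in> carrier S" and m: "m \<in> carrier S" and n: "n \<in> carrier S"
    by (simp_all add: x_def m_def n_def closed)
  have absorb: "u \<oplus> m \<oplus> \<one> \<oplus> m \<oplus> v = u \<oplus> m \<oplus> v"
    if uv: "u \<in> carrier S" "v \<in> carrier S" for u v
  proof -
    let ?u = "inv x \<otimes> u" and ?v = "inv x \<otimes> v"
    have "x \<otimes> (?u \<oplus> \<mu> \<one> \<oplus> ?v) = x \<otimes> (?u \<oplus> ?v)"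
      using middle_neutralD[OF mu_one_middle_neutral] uv x by (simp add: closed)
    moreover have "x \<otimes> \<mu> \<one> = \<one>"
      by (simp add: x_def closed)
    ultimately show ?thesis
      using uv x by (simp add: near_distrib closed m_def flip: m_assoc)
  qed
  have inv: "u \<oplus> (m \<oplus> n \<oplus> m) \<oplus> v = u \<oplus> v" if "u \<in> carrier S" "v \<in> carrier S" for u v
    using middle_neutralD[OF mu_invertible[OF x]] that by (simp add: m_def n_def)
  have one_m: "u \<oplus> \<one> \<oplus> m \<oplus> v = u \<oplus> v" if uv: "u \<in> carrier S" "v \<in> carrier S" for u v
  proof -
    have "u \<oplus> \<one> \<oplus> m \<oplus> v = u \<oplus> m \<oplus> n \<oplus> m \<oplus> \<one> \<oplus> m \<oplus> v"
      using inv[of u "\<one> \<oplus> m \<oplus> v"] uv m n by (simp add: closed add_assoc)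
    also have "\<dots> = u \<oplus> (m \<oplus> n \<oplus> m) \<oplus> v"
      using absorb[of "u \<oplus> m \<oplus> n" v] uv m n by (simp add: closed add_assoc)
    finally show ?thesis
      using inv uv by simp
  qed
  show ?thesis
  proof (rule middle_neutralI)
    fix u v assume uv: "u \<in> carrier S" "v \<in> carrier S"
    have "u \<oplus> \<one> \<oplus> v = u \<oplus> (\<one> \<oplus> \<one>) \<oplus> m \<oplus> v"
      using one_m[of "u \<oplus> \<one>" v] uv m by (simp add: closed add_assoc)
    then show "u \<oplus> \<one> \<oplus> v = u \<oplus> v"
      using one_m uv by (simp add: idem)
  qed
qed

section \<open>Adjusting the map to each condition\<close>

lemma near_if_congruent:
  assumes "\<nu> \<in> carrier S \<rightarrow> carrier S"
    and "\<And>x y z. \<lbrakk>x \<in> carrier S; y \<in> carrier S; z \<in> carrier S\<rbrakk>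
      \<Longrightarrow> x \<otimes> y \<oplus> \<nu> x \<oplus> x \<otimes> z = x \<otimes> y \<oplus> \<mu> x \<oplus> x \<otimes> z"
  shows "near_left_semibrace S \<nu>"
  using assms by unfold_locales (simp_all add: near_distrib)

text \<open>
  Dividing \<open>\<one> \<oplus> \<one>\<close> by itself writes \<open>\<one>\<close> as \<open>g \<oplus> m \<oplus> g\<close> with \<open>g\<close> the inverse of \<open>\<one> \<oplus> \<one>\<close> and
  \<open>m = \<mu> g\<close>. This sum is neutral in the quotient, which makes \<open>g\<close> and \<open>m\<close> commute there; regrouping
  \<open>(g \<oplus> m \<oplus> g) \<oplus> (g \<oplus> m \<oplus> g)\<close> then produces the sum \<open>g \<oplus> m \<oplus> g\<close> in its interior, where it can be
  dropped. The outer summands \<open>g\<close> are what allows calculating modulo the congruence.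
\<close>

lemma one_idem_if_neutral:
  assumes neutral: "middle_neutral S \<one>"
  shows "\<one> \<oplus> \<one> = \<one>"
proof -
  define g where "g = inv (\<one> \<oplus> \<one>)"
  define m where "m = \<mu> g"
  have g: "g \<in> carrier S" and m: "m \<in> carrier S"
    by (simp_all add: g_def m_def closed)
  have one: "g \<oplus> m \<oplus> g = \<one>"
  proof -
    have "g \<otimes> (\<one> \<oplus> \<one>) = \<one>"
      by (simp add: g_def closed)
    then show ?thesis
      using g by (simp add: near_distrib m_def)
  qed
  have comm: "u \<oplus> g \<oplus> m \<oplus> v = u \<oplus> m \<oplus> g \<oplus> v" if uv: "u \<in> carrier S" "v \<in> carrier S" for u v
  proof -
    have "u \<oplus> g \<oplus> m \<oplus> v = u \<oplus> g \<oplus> m \<oplus> (g \<oplus> m \<oplus> g) \<oplus> v"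
      using middle_neutralD[OF neutral] uv g m by (simp add: one closed)
    also have "\<dots> = u \<oplus> (g \<oplus> m \<oplus> g) \<oplus> (m \<oplus> g \<oplus> v)"
      using uv g m by (simp add: closed add_assoc)
    also have "\<dots> = u \<oplus> m \<oplus> g \<oplus> v"
      using middle_neutralD[OF neutral] uv g m by (simp add: one closed add_assoc)
    finally show ?thesis .
  qed
  have "\<one> \<oplus> \<one> = g \<oplus> m \<oplus> g \<oplus> (g \<oplus> m \<oplus> g)"
    by (simp add: one)
  also have "\<dots> = g \<oplus> g \<oplus> m \<oplus> (g \<oplus> m \<oplus> g)"
    using comm[of g "g \<oplus> m \<oplus> g"] g m by (simp add: closed)
  also have "\<dots> = g \<oplus> (g \<oplus> m \<oplus> g) \<oplus> (m \<oplus> g)"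
    using g m by (simp add: closed add_assoc)
  also have "\<dots> = g \<oplus> m \<oplus> g"
    using middle_neutralD[OF neutral, of g "m \<oplus> g"] g m by (simp add: one closed flip: add_assoc)
  finally show ?thesis
    by (simp add: one)
qed

lemma sandwich:
  assumes "middle_neutral S \<one>" "x \<in> carrier S"
  shows "x \<oplus> \<mu> x \<oplus> x = x"
  using near_distrib[of x \<one> \<one>] one_idem_if_neutral assms by simp

lemma near_one_plus_mu:
  assumes "middle_neutral S \<one>"
  shows "near_left_semibrace S (\<lambda>x. \<one> \<oplus> \<mu> x)"
proof (rule near_if_congruent)
  fix x y z assume xyz: "x \<in> carrier S" "y \<in> carrier S" "z \<in> carrier S"
  then show "x \<otimes> y \<oplus> (\<one> \<oplus> \<mu> x) \<oplus> x \<otimes> z = x \<otimes> y \<oplus> \<mu> x \<oplus> x \<otimes> z"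
    using middle_neutralD[OF assms, of "x \<otimes> y" "\<mu> x"] by (simp add: closed flip: add_assoc)
qed (simp add: closed)

lemma near_mu_plus_one:
  assumes "middle_neutral S \<one>"
  shows "near_left_semibrace S (\<lambda>x. \<mu> x \<oplus> \<one>)"
proof (rule near_if_congruent)
  fix x y z assume xyz: "x \<in> carrier S" "y \<in> carrier S" "z \<in> carrier S"
  then show "x \<otimes> y \<oplus> (\<mu> x \<oplus> \<one>) \<oplus> x \<otimes> z = x \<otimes> y \<oplus> \<mu> x \<oplus> x \<otimes> z"
    using middle_neutralD[OF assms, of "\<mu> x" "x \<otimes> z"] by (simp add: closed add_assoc)
qed (simp add: closed)

text \<open>
  This is the usual passage from an inner inverse to a reflexive one. The new map is congruent to \<open>\<mu>\<close>
  since both \<open>x \<otimes> y \<oplus> \<mu> x \<oplus> x \<oplus> \<mu> x \<oplus> x \<otimes> z\<close> and \<open>x \<otimes> y \<oplus> \<mu> x \<oplus> x \<otimes> z\<close> fold up to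
  \<open>x \<otimes> (y \<oplus> z)\<close>; the former does so via \<open>x \<otimes> (y \<oplus> \<one> \<oplus> z)\<close>.
\<close>

lemma near_mu_x_mu:
  assumes "middle_neutral S \<one>"
  shows "near_left_semibrace S (\<lambda>x. \<mu> x \<oplus> x \<oplus> \<mu> x)"
proof (rule near_if_congruent)
  fix x y z assume xyz: "x \<in> carrier S" "y \<in> carrier S" "z \<in> carrier S"
  have "x \<otimes> y \<oplus> (\<mu> x \<oplus> x \<oplus> \<mu> x) \<oplus> x \<otimes> z = x \<otimes> (y \<oplus> \<one> \<oplus> z)"
    using xyz by (simp add: near_distrib closed add_assoc)
  also have "\<dots> = x \<otimes> y \<oplus> \<mu> x \<oplus> x \<otimes> z"
    using middle_neutralD[OF assms] xyz by (simp add: near_distrib)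
  finally show "x \<otimes> y \<oplus> (\<mu> x \<oplus> x \<oplus> \<mu> x) \<oplus> x \<otimes> z = x \<otimes> y \<oplus> \<mu> x \<oplus> x \<otimes> z" .
qed (simp add: closed)

lemma mu_x_mu_sandwich:
  assumes "middle_neutral S \<one>" "x \<in> carrier S"
  shows "(\<mu> x \<oplus> x \<oplus> \<mu> x) \<oplus> x \<oplus> (\<mu> x \<oplus> x \<oplus> \<mu> x) = \<mu> x \<oplus> x \<oplus> \<mu> x"
proof -
  have "(\<mu> x \<oplus> x \<oplus> \<mu> x) \<oplus> x \<oplus> (\<mu> x \<oplus> x \<oplus> \<mu> x) =
      \<mu> x \<oplus> (x \<oplus> \<mu> x \<oplus> x) \<oplus> \<mu> x \<oplus> x \<oplus> \<mu> x"
    using assms(2) by (simp add: closed add_assoc)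
  also have "\<dots> = \<mu> x \<oplus> (x \<oplus> \<mu> x \<oplus> x) \<oplus> \<mu> x"
    using assms(2) by (simp add: sandwich[OF assms] closed add_assoc)
  finally show ?thesis
    using assms by (simp add: sandwich)
qed

end

section \<open>The characterization\<close>

theorem theorem4p6:
  fixes S :: "('a, 'b) add_mult_scheme" (structure)
    and P :: "('a \<Rightarrow> 'a) \<Rightarrow> bool"
  assumes "add_semigroup S"
    and "group S"
    and "P \<in> {\<lambda>\<mu>. \<forall>x\<in>carrier S. \<one> \<oplus> \<mu> x = \<mu> x,
               \<lambda>\<mu>. \<forall>x\<in>carrier S. \<mu> x \<oplus> \<one> = \<mu> x,
               \<lambda>\<mu>. \<forall>x\<in>carrier S. x \<oplus> \<mu> x \<oplus> x = x,
               \<lambda>\<mu>. \<forall>x\<in>carrier S. \<mu> x \<oplus> x \<oplus> \<mu> x = \<mu> x}"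
  shows "strong_left_semibrace S \<longleftrightarrow>
    (\<exists>\<mu>. \<mu> \<in> carrier S \<rightarrow> carrier S \<and> P \<mu> \<and> near_left_semibrace S \<mu>)"
proof
  assume "strong_left_semibrace S"
  then interpret strong_left_semibrace S .
  define \<mu> where "\<mu> = (\<lambda>x. x \<otimes> (inv x \<oplus> inv x))"
  interpret near_left_semibrace S \<mu>
    unfolding \<mu>_def by (rule strong_imp_near)
  note neutral = one_middle_neutral
  have "\<exists>\<nu>. P \<nu> \<and> near_left_semibrace S \<nu>"
    using assms(3)
  proof (elim insertE emptyE)
    assume P: "P = (\<lambda>\<mu>. \<forall>x\<in>carrier S. \<one> \<oplus> \<mu> x = \<mu> x)"
    have "P (\<lambda>x. \<one> \<oplus> \<mu> x)"
      using middle_neutralD[OF neutral] by (simp add: P closed flip: add_assoc)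
    with near_one_plus_mu[OF neutral] show ?thesis by blast
  next
    assume P: "P = (\<lambda>\<mu>. \<forall>x\<in>carrier S. \<mu> x \<oplus> \<one> = \<mu> x)"
    have "P (\<lambda>x. \<mu> x \<oplus> \<one>)"
      using middle_neutralD[OF neutral] by (simp add: P closed)
    with near_mu_plus_one[OF neutral] show ?thesis by blast
  next
    assume P: "P = (\<lambda>\<mu>. \<forall>x\<in>carrier S. x \<oplus> \<mu> x \<oplus> x = x)"
    have "P \<mu>"
      using sandwich[OF neutral] by (simp add: P)
    with near_left_semibrace_axioms show ?thesis by blast
  next
    assume P: "P = (\<lambda>\<mu>. \<forall>x\<in>carrier S. \<mu> x \<oplus> x \<oplus> \<mu> x = \<mu> x)"
    have "P (\<lambda>x. \<mu> x \<oplus> x \<oplus> \<mu> x)"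
      using mu_x_mu_sandwich[OF neutral] by (simp add: P)
    with near_mu_x_mu[OF neutral] show ?thesis by blast
  qed
  then show "\<exists>\<mu>. \<mu> \<in> carrier S \<rightarrow> carrier S \<and> P \<mu> \<and> near_left_semibrace S \<mu>"
    using near_left_semibrace.mu_closed by blast
next
  assume "\<exists>\<mu>. \<mu> \<in> carrier S \<rightarrow> carrier S \<and> P \<mu> \<and> near_left_semibrace S \<mu>"
  then obtain \<mu> where P\<mu>: "P \<mu>" and "near_left_semibrace S \<mu>"
    by blast
  then interpret near_left_semibrace S \<mu> by simp
  have "middle_neutral S \<one>"
    using assms(3)
  proof (elim insertE emptyE)
    assume "P = (\<lambda>\<mu>. \<forall>x\<in>carrier S. \<one> \<oplus> \<mu> x = \<mu> x)"
    with P\<mu> show ?thesis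
      by (intro neutral_if_left_absorbed) simp
  next
    assume "P = (\<lambda>\<mu>. \<forall>x\<in>carrier S. \<mu> x \<oplus> \<one> = \<mu> x)"
    with P\<mu> show ?thesis
      by (intro neutral_if_right_absorbed) simp
  next
    assume "P = (\<lambda>\<mu>. \<forall>x\<in>carrier S. x \<oplus> \<mu> x \<oplus> x = x)"
    with P\<mu> have "\<one> \<oplus> \<mu> \<one> \<oplus> \<one> = \<one>"
      by simp
    then show ?thesis
      using middle_neutralD[OF mu_one_middle_neutral] by (intro neutral_if_one_idem) simp
  next
    assume "P = (\<lambda>\<mu>. \<forall>x\<in>carrier S. \<mu> x \<oplus> x \<oplus> \<mu> x = \<mu> x)"
    with P\<mu> show ?thesis
      by (intro neutral_if_absorbed_between) simp
  qed
  then show "strong_left_semibrace S"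
    by (rule strong_if_middle_neutral)
qed

end
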